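(* Let $\psi[0]\in[-1,1]^m$ and $x[0]\in\mathbb{R}^c$, and let $\{x[k]\}$, $\{\psi[k]\}$, $\{\theta_r[k]\}$ be real sequences generated by the Lossy Modified DC Power Flow iteration $$x[k+1] = x[k] - (C^{\mathsf T}\mathsf{D}_B^{-1}C)^{-1}C^{\mathsf T}\arcsin(\psi[k]),$$ $$\psi[k+1] = A_r^{\mathsf T}\mathsf{L}_B^{-1}\Big(P_r - G_{\rm diag}V_r^2 + |A|_r\mathsf{D}_G\sqrt{\mathbf{1}_m-(\psi[k])^2}\Big) + \mathsf{D}_B^{-1}C\,x[k+1],$$ $$\theta_r[k+1] = (A_rA_r^{\mathsf T})^{-1}A_r\arcsin(\psi[k+1]).$$ If $x[k]\to x^*\in\mathbb{R}^c$ and $\psi[k]\to\psi^*\in\mathbb{R}^m$ as $k\to\infty$, then the sequence $\{A_r^{\mathsf T}\theta_r[k]\}$ of phase differences converges to a vector $A_r^{\mathsf T}\theta_r^*$, with $\theta_r^*\in\mathbb{R}^n$, which satisfies $A_r^{\mathsf T}\theta_r^* = \arcsin(\psi^* )$ componentwise modulo $2\pi$ and is a solution of the active power flow equations, i.e. $\theta_r^*=(\theta_1,\dots,\theta_n)$ together with $\theta_{n+1}=0$ satisfies, for all $i\in\{1,\dots,n\}$, $$P_i = \sum_{j\neq i}B_{ij}V_iV_j\sin(\theta_i-\theta_j) + G_{ii}V_i^2 + \sum_{j\neq i}G_{ij}V_iV_j\cos(\theta_i-\theta_j).$$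
   Context: Network: a connected graph $(\mathcal N,\mathcal E)$ with buses $\mathcal N=\{1,\dots,n+1\}$ and $m$ branches; bus $n+1$ is the slack bus with $\theta_{n+1}=0$. The voltage magnitudes $V_i>0$ ($i=1,\dots,n+1$) and the injections $P_i\in\mathbb{R}$ ($i=1,\dots,n$) are fixed; the angles $\theta_1,\dots,\theta_n$ are unknown. The symmetric admittance matrix is $Y=G+\mathrm{j}B$ with $G,B$ real. For a branch between $i$ and $j$, $Y_{ij}=-y_{ij}/t_{ij}$, where $y_{ij}$ is the transfer admittance (nonnegative real part, negative imaginary part) and $t_{ij}\ge1$ is the tap ratio, so $G_{ij}\le 0$ and $B_{ij}>0$ on branches; $Y_{ij}=0$ if $i\ne j$ are not joined by a branch; and $Y_{ii}=\sum_{j} y_{ij}/t_{ij}^2$, the sum being over the buses $j$ adjacent to $i$. Each branch has an arbitrary orientation. The node-edge incidence matrix $A\in\mathbb{R}^{(n+1)\times m}$ has $A_{ke}=1$ if $k$ is the source of $e$, $-1$ if $k$ is the sink of $e$, and $0$ otherwise. $A_r\in\mathbb{R}^{n\times m}$ is $A$ with the row of the slack bus removed; $|A|_r$ is $A_r$ with every nonzero entry replaced by $1$. $c=\dim\ker A$, and $C\in\{-1,0,1\}^{m\times c}$ is an oriented edge-cycle incidence matrix: its columns index cycles of the network and form a basis of $\ker A$. $\mathsf{D}_B$ and $\mathsf{D}_G$ are the $m\times m$ diagonal matrices with entries $V_iV_jB_{ij}$ and $V_iV_j|G_{ij}|$, respectively, for the branch $(i,j)$; $\mathsf{D}_B$ is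 positive definite. $\mathsf{L}_B=A_r\mathsf{D}_BA_r^{\mathsf T}$ (positive definite). $G_{\rm diag}\in\mathbb{R}^{n\times n}$ is diagonal with entries $G_{ii}$; $V_r^2=(V_1^2,\dots,V_n^2)^{\mathsf T}$; $P_r=(P_1,\dots,P_n)^{\mathsf T}$; $\mathbf{1}_m$ is the all-ones vector. Squares, square roots and $\arcsin$ of vectors are taken componentwise, $\arcsin:[-1,1]\to[-\pi/2,\pi/2]$; the iteration generates real sequences exactly when $\|\psi[k]\|_\infty\le1$ for all $k$. If the network is radial ($c=0$) the $x$-variables and terms containing $C$ are absent. *)

theory Defs
  imports
    Complex_Main
    "HOL-Library.Real_Mod"
    "Graph_Theory.Digraph_Component"
    "Jordan_Normal_Form.Matrix_Kernel"
begin

(* Buses are 0..nred, the slack bus being the last one; branches are 0..<nbr.  The functions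
   src and snk give the (arbitrary) orientation of the branches.  The transfer admittance
   yadm and the tap ratio tap are indexed by the two end buses of a branch. *)
record network =
  nred :: nat
  nbr :: nat
  src :: "nat \<Rightarrow> nat"
  snk :: "nat \<Rightarrow> nat"
  yadm :: "nat \<Rightarrow> nat \<Rightarrow> complex"
  tap :: "nat \<Rightarrow> nat \<Rightarrow> real"
  volt :: "real vec"
  pinj :: "real vec"

definition net_graph :: "network \<Rightarrow> (nat, nat) pre_digraph" where
  "net_graph N = \<lparr> verts = {..nred N}, arcs = {..<nbr N}, tail = src N, head = snk N \<rparr>"

definition adjacent :: "network \<Rightarrow> nat \<Rightarrow> nat \<Rightarrow> bool" where
  "adjacent N i j \<longleftrightarrow> (\<exists>e<nbr N. {src N e, snk N e} = {i, j})"

definition Ymat :: "network \<Rightarrow> complex mat" where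
  "Ymat N = mat (nred N + 1) (nred N + 1) (\<lambda>(i, j).
     if i = j then \<Sum>k | k \<le> nred N \<and> adjacent N i k. yadm N i k / of_real ((tap N i k)\<^sup>2)
     else if adjacent N i j then - yadm N i j / of_real (tap N i j)
     else 0)"

definition Gmat :: "network \<Rightarrow> real mat" where
  "Gmat N = map_mat Re (Ymat N)"

definition Bmat :: "network \<Rightarrow> real mat" where
  "Bmat N = map_mat Im (Ymat N)"

(* The injectivity condition says that no two branches join the same pair of buses. *)
definition power_network :: "network \<Rightarrow> bool" where
  "power_network N \<longleftrightarrow>
     loopfree_digraph (net_graph N) \<and>
     inj_on (\<lambda>e. {src N e, snk N e}) {..<nbr N} \<and>
     Digraph_Component.connected (net_graph N) \<and>
     (\<forall>i j. adjacent N i j \<longrightarrow> Re (yadm N i j) \<ge> 0 \<and> Im (yadm N i j) < 0 \<and> tap N i j \<ge> 1) \<and>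
     transpose_mat (Ymat N) = Ymat N \<and>
     volt N \<in> carrier_vec (nred N + 1) \<and> (\<forall>i\<le>nred N. volt N $ i > 0) \<and>
     pinj N \<in> carrier_vec (nred N)"

definition Amat :: "network \<Rightarrow> real mat" where
  "Amat N = mat (nred N + 1) (nbr N)
     (\<lambda>(k, e). if k = src N e then 1 else if k = snk N e then - 1 else 0)"

definition A_r :: "network \<Rightarrow> real mat" where
  "A_r N = mat (nred N) (nbr N) (\<lambda>(k, e). Amat N $$ (k, e))"

definition absA_r :: "network \<Rightarrow> real mat" where
  "absA_r N = map_mat (\<lambda>a. if a = 0 then 0 else 1) (A_r N)"

definition D_B :: "network \<Rightarrow> real mat" where
  "D_B N = mat_diag (nbr N)
     (\<lambda>e. volt N $ src N e * volt N $ snk N e * Bmat N $$ (src N e, snk N e))"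

definition D_G :: "network \<Rightarrow> real mat" where
  "D_G N = mat_diag (nbr N)
     (\<lambda>e. volt N $ src N e * volt N $ snk N e * \<bar>Gmat N $$ (src N e, snk N e)\<bar>)"

definition L_B :: "network \<Rightarrow> real mat" where
  "L_B N = A_r N * D_B N * transpose_mat (A_r N)"

definition G_diag :: "network \<Rightarrow> real mat" where
  "G_diag N = mat_diag (nred N) (\<lambda>i. Gmat N $$ (i, i))"

definition V_r_sq :: "network \<Rightarrow> real vec" where
  "V_r_sq N = map_vec (\<lambda>v. v\<^sup>2) (vec_first (volt N) (nred N))"

(* Signed indicator vector of the branches traversed by a closed walk, the walk being a list
   of ordered pairs of buses. *)
definition cycle_vec :: "network \<Rightarrow> (nat \<times> nat) list \<Rightarrow> real vec" where
  "cycle_vec N p = vec (nbr N) (\<lambda>e.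
     if (src N e, snk N e) \<in> set p then 1
     else if (snk N e, src N e) \<in> set p then - 1
     else 0)"

(* The constraint on the length is needed because the symmetric digraph mk_symmetric G has the
   cycles u, v, u of length 2, which are not cycles of the undirected graph. *)
definition cycle_matrix :: "network \<Rightarrow> real mat \<Rightarrow> bool" where
  "cycle_matrix N C \<longleftrightarrow>
     C \<in> carrier_mat (nbr N) (kernel_dim (Amat N)) \<and>
     (\<forall>e<nbr N. \<forall>l<kernel_dim (Amat N). C $$ (e, l) \<in> {-1, 0, 1}) \<and>
     (\<forall>l<kernel_dim (Amat N). \<exists>p.
        pre_digraph.cycle (with_proj (mk_symmetric (net_graph N))) p \<and> length p \<ge> 3 \<and>
        col C l = cycle_vec N p) \<and>
     kernel.basis (nbr N) (Amat N) (set (cols C))"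

(* Only applied to invertible matrices; the value is unspecified otherwise. *)
definition inv_mat :: "real mat \<Rightarrow> real mat" where
  "inv_mat M = the (mat_inverse M)"

definition vec_tendsto :: "(nat \<Rightarrow> real vec) \<Rightarrow> real vec \<Rightarrow> bool" where
  "vec_tendsto X L \<longleftrightarrow>
     (\<forall>k. dim_vec (X k) = dim_vec L) \<and> (\<forall>i<dim_vec L. (\<lambda>k. X k $ i) \<longlonglongrightarrow> L $ i)"

definition active_power_flow :: "network \<Rightarrow> real vec \<Rightarrow> bool" where
  "active_power_flow N \<theta> \<longleftrightarrow> (\<forall>i<nred N.
     pinj N $ i =
       (\<Sum>j\<in>{..nred N} - {i}. Bmat N $$ (i, j) * volt N $ i * volt N $ j * sin (\<theta> $ i - \<theta> $ j))
       + Gmat N $$ (i, i) * (volt N $ i)\<^sup>2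
       + (\<Sum>j\<in>{..nred N} - {i}. Gmat N $$ (i, j) * volt N $ i * volt N $ j * cos (\<theta> $ i - \<theta> $ j)))"

end

(* At a fixed point the x-update forces C^T arcsin(psi) = 0, so arcsin(psi) is orthogonal to
   ker A = ker A_r, hence lies in the range of A_r^T, and the least-squares angles reproduce it
   exactly (not only modulo 2 pi).  Applying A_r D_B to the psi-update kills the cycle term and
   leaves the nodal balance A_r D_B psi = P - G_diag V^2 + |A|_r D_G sqrt(1 - psi^2), which is the
   power flow equation since psi and sqrt(1 - psi^2) are the sine and cosine of arcsin(psi). *)
theory Submission
  imports Defs
begin

section \<open>Real matrices and limits of vectors\<close>

text \<open>\<open>inv_mat\<close> is unspecified on singular matrices, so each inverse in the
  iteration has to be earned. Apart from the diagonal \<open>D_B\<close>, the matrices inverted are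
  Gram matrices with positive diagonal weights, which reduces the question to injectivity of a
  rectangular factor: for the transpose of \<open>A_r\<close> this comes from connectedness together
  with the grounded slack bus, for \<open>C\<close> from the independence of a basis. Convergence is
  assumed, so the rest is passage to the limit through continuous maps. The delicate one is
  \<open>arcsin\<close>, continuous only on the closed interval from -1 to 1; the bound on the
  iterates keeps the limit in that interval. A radial network needs no separate case:
  \<open>C\<close> then has no columns, and the arguments apply verbatim to vectors of dimension
  0.\<close>

lemma inv_mat_of_injective:
  assumes Q: "Q \<in> carrier_mat n n"
    and inj: "\<And>v. v \<in> carrier_vec n \<Longrightarrow> Q *\<^sub>v v = 0\<^sub>v n \<Longrightarrow> v = 0\<^sub>v n"
  shows "Q * inv_mat Q = 1\<^sub>m n" "inv_mat Q * Q = 1\<^sub>m n" "inv_mat Q \<in> carrier_mat n n"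
proof -
  \<comment> \<open>A square matrix with trivial kernel is a unit of the matrix ring, and this is
    what excludes the outcome \<open>None\<close> of \<open>mat_inverse\<close>.\<close>
  have "det Q \<noteq> 0"
    using det_0_iff_vec_prod_zero[OF Q] inj by blast
  then have "Q \<in> Units (ring_mat TYPE(real) n ())"
    by (rule det_non_zero_imp_unit[OF Q])
  then obtain R where "mat_inverse Q = Some R"
    using mat_inverse(1)[OF Q, of "()"] by (cases "mat_inverse Q") auto
  then show "Q * inv_mat Q = 1\<^sub>m n" "inv_mat Q * Q = 1\<^sub>m n" "inv_mat Q \<in> carrier_mat n n"
    using mat_inverse(2)[OF Q] by (auto simp: inv_mat_def)
qed

lemma mult_mat_vec_index_sum:
  assumes "M \<in> carrier_mat r k" "v \<in> carrier_vec k" "i < r"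
  shows "(M *\<^sub>v v) $ i = (\<Sum>j<k. M $$ (i, j) * v $ j)"
  using assms by (simp add: scalar_prod_def lessThan_atLeast0)

lemma mat_diag_mult_vec_index:
  assumes "v \<in> carrier_vec k" "e < k"
  shows "(mat_diag k d *\<^sub>v v) $ e = d e * v $ e"
proof -
  have "(mat_diag k d *\<^sub>v v) $ e = (\<Sum>i<k. mat_diag k d $$ (e, i) * v $ i)"
    by (rule mult_mat_vec_index_sum[OF mat_diag_dim assms])
  also have "\<dots> = (\<Sum>i<k. if e = i then d i * v $ i else 0)"
    using assms by (intro sum.cong) (auto simp: mat_diag_def)
  finally show ?thesis using assms by simp
qed

text \<open>The explicit entries, and not just invertibility, matter: they exhibit the inverse of
  \<open>D_B\<close> as a diagonal of positive weights, so that the cycle matrix of the x-update is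
  again a weighted Gram matrix.\<close>

lemma inv_mat_diag:
  fixes d :: "nat \<Rightarrow> real"
  assumes d: "\<And>e. e < k \<Longrightarrow> d e \<noteq> 0"
  shows "inv_mat (mat_diag k d) = mat_diag k (\<lambda>e. inverse (d e))"
    and "mat_diag k d * inv_mat (mat_diag k d) = 1\<^sub>m k"
proof -
  let ?D = "mat_diag k d" and ?E = "mat_diag k (\<lambda>e. inverse (d e))"
  have ED: "?E * ?D = 1\<^sub>m k"
    using d by (subst mat_diag_diag) (auto simp: mat_diag_def intro!: eq_matI)
  have inj: "v = 0\<^sub>v k" if v: "v \<in> carrier_vec k" and 0: "?D *\<^sub>v v = 0\<^sub>v k" for v
  proof
    fix e assume e: "e < dim_vec (0\<^sub>v k :: real vec)"
    then have "d e * v $ e = 0"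
      using mat_diag_mult_vec_index[OF v, of e d] 0 by simp
    then show "v $ e = 0\<^sub>v k $ e"
      using d e by simp
  qed (use v in simp)
  have inv: "?D * inv_mat ?D = 1\<^sub>m k" "inv_mat ?D \<in> carrier_mat k k"
    using inv_mat_of_injective[OF mat_diag_dim inj] by blast+
  have "inv_mat ?D = (?E * ?D) * inv_mat ?D"
    unfolding ED using inv(2) by simp
  also have "\<dots> = ?E * (?D * inv_mat ?D)"
    by (rule assoc_mult_mat[OF mat_diag_dim mat_diag_dim inv(2)])
  also have "\<dots> = ?E"
    unfolding inv(1) by (rule right_mult_one_mat[OF mat_diag_dim])
  finally show "inv_mat ?D = ?E" .
  show "?D * inv_mat ?D = 1\<^sub>m k" by (rule inv(1))
qed

text \<open>The quadratic form of the Gram matrix at \<open>v\<close> is the sum of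
  \<open>d e\<close> times the squared entries of \<open>M *\<^sub>v v\<close>; positive weights
  force each square to vanish. It serves three times: with unit weights, with the entries of
  \<open>D_B\<close>, and with their inverses.\<close>

lemma weighted_gram_injective:
  fixes M :: "real mat"
  assumes M: "M \<in> carrier_mat k l"
    and d: "\<And>e. e < k \<Longrightarrow> d e > 0"
    and inj: "\<And>v. v \<in> carrier_vec l \<Longrightarrow> M *\<^sub>v v = 0\<^sub>v k \<Longrightarrow> v = 0\<^sub>v l"
    and v: "v \<in> carrier_vec l" and 0: "(transpose_mat M * mat_diag k d * M) *\<^sub>v v = 0\<^sub>v l"
  shows "v = 0\<^sub>v l"
proof -
  let ?D = "mat_diag k d" and ?w = "M *\<^sub>v v"
  have w: "?w \<in> carrier_vec k"
    by (rule mult_mat_vec_carrier[OF M v])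
  have Dw: "?D *\<^sub>v ?w \<in> carrier_vec k"
    by (rule mult_mat_vec_carrier[OF mat_diag_dim w])
  have tM: "transpose_mat M \<in> carrier_mat l k" using M by simp
  have tMD: "transpose_mat M * ?D \<in> carrier_mat l k"
    by (rule mult_carrier_mat[OF tM mat_diag_dim])
  have "0\<^sub>v l = transpose_mat M *\<^sub>v (?D *\<^sub>v ?w)"
    using assoc_mult_mat_vec[OF tMD M v] assoc_mult_mat_vec[OF tM mat_diag_dim w, of d] 0 by simp
  then have "0 = (?D *\<^sub>v ?w) \<bullet> ?w"
    using transpose_vec_mult_scalar[OF M v Dw] scalar_prod_left_zero[OF v] by metis
  also have "\<dots> = (\<Sum>e<k. d e * (?w $ e)\<^sup>2)"
    using w M mat_diag_mult_vec_index[OF w, of _ d] unfolding scalar_prod_def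
    by (auto simp: power2_eq_square lessThan_atLeast0 simp del: index_mult_mat_vec intro!: sum.cong)
  finally have "\<forall>e\<in>{..<k}. d e * (?w $ e)\<^sup>2 = 0"
    using d by (subst (asm) eq_commute, subst (asm) sum_nonneg_eq_0_iff) (auto simp: less_imp_le)
  then have "?w $ e = 0" if "e < k" for e
    using d[OF that] that by (auto dest!: bspec[of _ _ e] simp del: index_mult_mat_vec)
  then have "?w = 0\<^sub>v k"
    using w by (intro eq_vecI) (simp_all del: index_mult_mat_vec dim_mult_mat_vec)
  then show ?thesis by (rule inj[OF v])
qed

section \<open>Limits of vector sequences\<close>

lemma vec_tendsto_mult_mat:
  assumes "M \<in> carrier_mat r n" "L \<in> carrier_vec n" "vec_tendsto X L"
  shows "vec_tendsto (\<lambda>k. M *\<^sub>v X k) (M *\<^sub>v L)"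
  using assms unfolding vec_tendsto_def
  by (auto simp: scalar_prod_def intro!: tendsto_intros)

lemma vec_tendsto_const: "vec_tendsto (\<lambda>_. L) L"
  by (simp add: vec_tendsto_def)

lemma vec_tendsto_add:
  assumes "vec_tendsto X L" "vec_tendsto Y K" "dim_vec L = dim_vec K"
  shows "vec_tendsto (\<lambda>k. X k + Y k) (L + K)"
  using assms unfolding vec_tendsto_def by (auto intro!: tendsto_intros)

lemma vec_tendsto_diff:
  assumes "vec_tendsto X L" "vec_tendsto Y K" "dim_vec L = dim_vec K"
  shows "vec_tendsto (\<lambda>k. X k - Y k) (L - K)"
  using assms unfolding vec_tendsto_def by (auto intro!: tendsto_intros)

text \<open>Continuity is asked only on a closed set because of \<open>arcsin\<close>; closedness
  puts the limit into the set, where continuity can be applied.\<close>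

lemma vec_tendsto_map:
  assumes "vec_tendsto X L" "continuous_on S f" "closed S"
    and S: "\<And>k i. i < dim_vec L \<Longrightarrow> X k $ i \<in> S"
  shows "vec_tendsto (\<lambda>k. map_vec f (X k)) (map_vec f L)"
proof -
  have lim: "(\<lambda>k. X k $ i) \<longlonglongrightarrow> L $ i" if "i < dim_vec L" for i
    using assms(1) that by (simp add: vec_tendsto_def)
  have LS: "L $ i \<in> S" if "i < dim_vec L" for i
    by (rule Lim_in_closed_set[OF \<open>closed S\<close> _ _ lim[OF that]]) (use S[OF that] in auto)
  have "(\<lambda>k. f (X k $ i)) \<longlonglongrightarrow> f (L $ i)" if "i < dim_vec L" for i
    by (rule continuous_on_tendsto_compose[OF assms(2) lim[OF that] LS[OF that]])
      (use S[OF that] in auto)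
  then show ?thesis
    using assms(1) by (auto simp: vec_tendsto_def)
qed

lemma vec_tendsto_Suc: "vec_tendsto X L \<Longrightarrow> vec_tendsto (\<lambda>k. X (Suc k)) L"
  by (auto simp: vec_tendsto_def intro: LIMSEQ_Suc)

text \<open>The recursion determines the angles only from index 1 on, while
  \<open>vec_tendsto\<close> constrains the dimension at every index; hence the condition on
  \<open>X 0\<close>.\<close>

lemma vec_tendsto_if_Suc:
  assumes "vec_tendsto (\<lambda>k. X (Suc k)) L" "dim_vec (X 0) = dim_vec L"
  shows "vec_tendsto X L"
proof -
  have "dim_vec (X k) = dim_vec L" for k
    using assms by (cases k) (auto simp: vec_tendsto_def)
  then show ?thesis
    using assms(1) by (auto simp: vec_tendsto_def intro: LIMSEQ_imp_Suc)
qed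

lemma vec_tendsto_unique:
  assumes "vec_tendsto X L" "vec_tendsto X K"
  shows "L = K"
proof
  show "dim_vec L = dim_vec K" 
    using assms by (auto simp: vec_tendsto_def)
  then show "L $ i = K $ i" if "i < dim_vec K" for i
    using assms that by (auto simp: vec_tendsto_def intro: LIMSEQ_unique)
qed

section \<open>Bases of a kernel as matrices\<close>

text \<open>This is the independence half of the basis property. The point to settle is that a basis
  is a set whereas a matrix has a list of columns.\<close>

lemma kernel_basis_matrix_injective:
  fixes C :: "real mat"
  assumes M: "M \<in> carrier_mat r k" and C: "C \<in> carrier_mat k (kernel_dim M)"
    and basis: "kernel.basis k M (set (cols C))"
    and v: "v \<in> carrier_vec (kernel_dim M)" and 0: "C *\<^sub>v v = 0\<^sub>v k"
  shows "v = 0\<^sub>v (kernel_dim M)"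
proof -
  interpret kernel r k M by unfold_locales (rule M)
  have sub: "set (cols C) \<subseteq> mat_kernel M"
    using basis by (simp add: Ker.basis_def)
  have indpt: "\<not> NC.lin_dep (set (cols C))"
    using basis lindep_same[OF sub] by (simp add: Ker.basis_def)
  have len: "length (cols C) = dim" using C by simp
  \<comment> \<open>Two equal columns would collapse in the set and leave a nontrivial relation
    undetected. Counting excludes them: there are as many columns as basis elements.\<close>
  have "card (set (cols C)) = dim"
    using Ker.dim_basis[OF _ basis] by simp
  then have dist: "distinct (cols C)"
    using len by (simp add: card_distinct)
  have colsC: "cols C ! i \<in> carrier_vec k" if "i < length (cols C)" for i
    using that C by (simp add: carrier_vecI)
  \<comment> \<open>The coefficients \<open>v\<close>, moved from positions to columns. The sum is
    the shape in which a matrix-vector product is known as a linear combination; distinct columns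
    leave one nonzero summand at most.\<close>
  define f where "f l = (\<Sum>i = 0..<length (cols C). if l = cols C ! i then v $ i else 0)" for l
  have f: "f (cols C ! i) = v $ i" if "i < dim" for i
  proof -
    have "f (cols C ! i) = (\<Sum>j = 0..<length (cols C). if i = j then v $ j else 0)"
      unfolding f_def using that len
      by (intro sum.cong refl) (simp add: nth_eq_iff_index_eq[OF dist] del: cols_nth)
    then show ?thesis using that len by simp
  qed
  have "NC.lincomb f (set (cols C)) = mat_of_cols k (cols C) *\<^sub>v v"
    unfolding f_def
    by (rule NC.mat_of_cols_mult_as_finsum[symmetric]) (use v len colsC in auto)
  also have "\<dots> = 0\<^sub>v k"
    using mat_of_cols_cols[of C] C 0 by auto
  finally have "NC.lincomb f (set (cols C)) = 0\<^sub>v k" .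
  then have "f l = 0" if "l \<in> set (cols C)" for l
    using indpt that unfolding NC.lin_dep_def by blast
  then have "v $ i = 0" if "i < dim" for i
    using f[OF that] len that by (metis nth_mem)
  then show ?thesis
    using v by (intro eq_vecI) auto
qed

text \<open>The spanning half: the span of the columns, taken inside the kernel, is the same as in
  the ambient space, where it is the column space of \<open>C\<close>.\<close>

lemma kernel_basis_matrix_image:
  fixes C :: "real mat"
  assumes M: "M \<in> carrier_mat r k" and C: "C \<in> carrier_mat k (kernel_dim M)"
    and basis: "kernel.basis k M (set (cols C))"
  shows "mat_kernel M = (*\<^sub>v) C ` carrier_vec (kernel_dim M)"
proof -
  interpret kernel r k M by unfold_locales (rule M)
  have "set (cols C) \<subseteq> mat_kernel M"
    using basis by (simp add: Ker.basis_def)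
  then have "NC.span (set (cols C)) = mat_kernel M"
    using basis span_same by (simp add: Ker.basis_def)
  then have "mat_kernel M = NC.col_space C"
    by (simp add: NC.col_space_def)
  then show ?thesis
    unfolding NC.col_space_eq[OF C] using C by (auto simp del: kernel_dim)
qed

section \<open>Networks\<close>

lemma adjacent_commute: "adjacent N i j \<longleftrightarrow> adjacent N j i"
  by (simp add: adjacent_def insert_commute)

lemma adjacent_branch: "e < nbr N \<Longrightarrow> adjacent N (src N e) (snk N e)"
  by (auto simp: adjacent_def)

lemma A_r_index:
  "i < nred N \<Longrightarrow> e < nbr N \<Longrightarrow>
    A_r N $$ (i, e) = (if i = src N e then 1 else if i = snk N e then - 1 else 0)"
  by (simp add: A_r_def Amat_def)

lemma A_r_carrier: "A_r N \<in> carrier_mat (nred N) (nbr N)"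
  and Amat_carrier: "Amat N \<in> carrier_mat (nred N + 1) (nbr N)"
  and absA_r_carrier: "absA_r N \<in> carrier_mat (nred N) (nbr N)"
  and D_B_carrier: "D_B N \<in> carrier_mat (nbr N) (nbr N)"
  and D_G_carrier: "D_G N \<in> carrier_mat (nbr N) (nbr N)"
  and G_diag_carrier: "G_diag N \<in> carrier_mat (nred N) (nred N)"
  by (simp_all add: A_r_def Amat_def absA_r_def D_B_def D_G_def G_diag_def)

context
  fixes N :: network
  assumes net: "power_network N"
begin

lemma branch_ends:
  assumes "e < nbr N"
  shows "src N e \<le> nred N" "snk N e \<le> nred N" "src N e \<noteq> snk N e"
proof -
  interpret loopfree_digraph "net_graph N"
    using net by (simp add: power_network_def)
  show "src N e \<le> nred N" "snk N e \<le> nred N" "src N e \<noteq> snk N e"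
    using tail_in_verts[of e] head_in_verts[of e] no_loops[of e] assms by (auto simp: net_graph_def)
qed

lemma adjacent_distinct: "adjacent N i j \<Longrightarrow> i \<le> nred N \<and> j \<le> nred N \<and> i \<noteq> j"
  using branch_ends unfolding adjacent_def by (metis doubleton_eq_iff)

lemma Ymat_commute:
  assumes "i \<le> nred N" "j \<le> nred N"
  shows "Ymat N $$ (i, j) = Ymat N $$ (j, i)"
proof -
  have "Ymat N $$ (i, j) = transpose_mat (Ymat N) $$ (i, j)"
    using net by (simp add: power_network_def)
  then show ?thesis using assms by (simp add: Ymat_def)
qed

text \<open>\<open>D_B\<close> and \<open>D_G\<close> read the admittance at (source, sink) only;
  symmetry makes these entries usable from the sink as well.\<close>

lemma Bmat_commute: "i \<le> nred N \<Longrightarrow> j \<le> nred N \<Longrightarrow> Bmat N $$ (i, j) = Bmat N $$ (j, i)"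
  and Gmat_commute: "i \<le> nred N \<Longrightarrow> j \<le> nred N \<Longrightarrow> Gmat N $$ (i, j) = Gmat N $$ (j, i)"
  using Ymat_commute[of i j] by (simp_all add: Bmat_def Gmat_def Ymat_def)

lemma Bmat_pos: "adjacent N i j \<Longrightarrow> Bmat N $$ (i, j) > 0"
  and Gmat_nonpos: "adjacent N i j \<Longrightarrow> Gmat N $$ (i, j) \<le> 0"
proof -
  assume ij: "adjacent N i j"
  then have y: "Re (yadm N i j) \<ge> 0" "Im (yadm N i j) < 0" "tap N i j \<ge> 1"
    using net by (auto simp: power_network_def)
  then show "Bmat N $$ (i, j) > 0" "Gmat N $$ (i, j) \<le> 0"
    using ij adjacent_distinct[OF ij]
    by (auto simp: Bmat_def Gmat_def Ymat_def divide_less_0_iff)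
qed

lemma Bmat_Gmat_nonadjacent:
  assumes "i \<le> nred N" "j \<le> nred N" "i \<noteq> j" "\<not> adjacent N i j"
  shows "Bmat N $$ (i, j) = 0" "Gmat N $$ (i, j) = 0"
  using assms by (simp_all add: Bmat_def Gmat_def Ymat_def)

lemma volt_pos: "i \<le> nred N \<Longrightarrow> volt N $ i > 0"
  using net by (simp add: power_network_def)

lemma D_B_entry_pos:
  "e < nbr N \<Longrightarrow> volt N $ src N e * volt N $ snk N e * Bmat N $$ (src N e, snk N e) > 0"
  using branch_ends Bmat_pos[OF adjacent_branch] volt_pos by simp

section \<open>Incidence matrices and their kernels\<close>

text \<open>Sending a branch at \<open>i\<close> to its opposite end is a bijection onto the
  neighbours of \<open>i\<close>, because no two branches join the same pair of buses. This turns
  matrix rows, indexed by branches, into the sums over buses of the power flow equations.\<close>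

lemma sum_incident_branches:
  fixes h :: "nat \<Rightarrow> real"
  shows "(\<Sum>e<nbr N. if i = src N e then h (snk N e) else if i = snk N e then h (src N e) else 0) =
    (\<Sum>j\<in>{..nred N} - {i}. if adjacent N i j then h j else 0)"
proof -
  \<comment> \<open>Meaningful only for branches that meet \<open>i\<close>; elsewhere the value is
    arbitrary.\<close>
  define other where "other e = (if i = src N e then snk N e else src N e)" for e
  let ?E = "{e. e < nbr N \<and> (i = src N e \<or> i = snk N e)}"
  let ?J = "{j. j \<le> nred N \<and> j \<noteq> i \<and> adjacent N i j}"
  have ends: "{src N e, snk N e} = {i, other e}" if "e \<in> ?E" for e
    using that by (auto simp: other_def)
  have inj: "inj_on other ?E"
  proof (rule inj_onI)
    fix e f assume "e \<in> ?E" "f \<in> ?E" "other e = other f"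
    then have "{src N e, snk N e} = {src N f, snk N f}"
      using ends by metis
    then show "e = f"
      using net \<open>e \<in> ?E\<close> \<open>f \<in> ?E\<close> by (auto simp: power_network_def inj_on_def)
  qed
  have img: "other ` ?E = ?J"
  proof
    show "other ` ?E \<subseteq> ?J"
    proof
      fix j assume "j \<in> other ` ?E"
      then obtain e where e: "e \<in> ?E" "j = other e" by blast
      then have "adjacent N i j"
        using ends[OF e(1)] by (auto simp: adjacent_def)
      then show "j \<in> ?J"
        using adjacent_distinct by blast
    qed
    show "?J \<subseteq> other ` ?E"
    proof
      fix j assume "j \<in> ?J"
      then obtain e where e: "e < nbr N" "{src N e, snk N e} = {i, j}" "j \<noteq> i"
        by (auto simp: adjacent_def)
      then have "e \<in> ?E" "j = other e"
        by (auto simp: other_def doubleton_eq_iff)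
      then show "j \<in> other ` ?E" by blast
    qed
  qed
  have "(\<Sum>e<nbr N. if i = src N e then h (snk N e) else if i = snk N e then h (src N e) else 0)
      = (\<Sum>e\<in>?E. h (other e))"
    by (rule sum.mono_neutral_cong_right) (auto simp: other_def)
  also have "\<dots> = (\<Sum>j\<in>?J. h j)"
    using sum.reindex[OF inj, of h] by (simp add: img)
  also have "\<dots> = (\<Sum>j\<in>{..nred N} - {i}. if adjacent N i j then h j else 0)"
    by (rule sum.mono_neutral_cong_left) auto
  finally show ?thesis .
qed

text \<open>The appended zero is the slack angle, at index \<open>nred N\<close>. The row missing
  from \<open>A_r\<close> and the value 0 of that angle have the same effect, so branches at the
  slack bus need no exception.\<close>

lemma A_r_transpose_mult_index:
  assumes v: "v \<in> carrier_vec (nred N)" and e: "e < nbr N"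
  shows "(transpose_mat (A_r N) *\<^sub>v v) $ e = (v @\<^sub>v 0\<^sub>v 1) $ src N e - (v @\<^sub>v 0\<^sub>v 1) $ snk N e"
proof -
  have ext: "(v @\<^sub>v 0\<^sub>v 1) $ j = (if j < nred N then v $ j else 0)" if "j \<le> nred N" for j
    using that v by auto
  \<comment> \<open>The signed entry splits into two separate indicators because source and sink
    differ.\<close>
  have "(transpose_mat (A_r N) *\<^sub>v v) $ e
      = (\<Sum>i<nred N. (if i = src N e then v $ i else 0) - (if i = snk N e then v $ i else 0))"
    using v e A_r_carrier[of N] branch_ends(3)[OF e]
    by (auto simp: scalar_prod_def lessThan_atLeast0 A_r_index intro!: sum.cong)
  also have "\<dots> = (if src N e < nred N then v $ src N e else 0)
      - (if snk N e < nred N then v $ snk N e else 0)"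
    by (simp add: sum_subtractf)
  finally show ?thesis
    using ext branch_ends[OF e] by simp
qed

text \<open>Vanishing differences along all branches make the potential constant on a connected
  graph, and its value at the slack bus is 0.\<close>

lemma A_r_transpose_injective:
  assumes v: "v \<in> carrier_vec (nred N)" and 0: "transpose_mat (A_r N) *\<^sub>v v = 0\<^sub>v (nbr N)"
  shows "v = 0\<^sub>v (nred N)"
proof -
  let ?w = "v @\<^sub>v 0\<^sub>v 1"
  have eq: "?w $ src N e = ?w $ snk N e" if "e < nbr N" for e
    using A_r_transpose_mult_index[OF v that] 0 that by simp
  interpret loopfree_digraph "net_graph N"
    using net by (simp add: power_network_def)
  interpret S: pair_wf_digraph "mk_symmetric (net_graph N)" ..
  have const: "?w $ i = ?w $ nred N" if i: "i \<le> nred N" for i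
  proof -
    \<comment> \<open>Connectedness is strong connectedness of the symmetric closure, so the path
      from the slack bus may traverse branches against their orientation; equality of the two end
      values does not depend on the direction.\<close>
    have "nred N \<rightarrow>\<^sup>*\<^bsub>with_proj (mk_symmetric (net_graph N))\<^esub> i"
      using net i
      by (auto simp: power_network_def Digraph_Component.connected_def strongly_connected_def
          net_graph_def)
    then show ?thesis
    proof (induct rule: S.reachable_induct)
      case (step x y)
      then show ?case
        using eq by (auto simp: parcs_mk_symmetric net_graph_def)
    qed simp
  qed
  have "v $ i = 0" if i: "i < nred N" for i
  proof -
    have "v $ i = ?w $ i" using v i by simp
    also have "\<dots> = ?w $ nred N" by (rule const[OF less_imp_le[OF i]])
    also have "\<dots> = 0" using v by simp
    finally show ?thesis .
  qed
  then show ?thesis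
    using v by (intro eq_vecI) auto
qed

lemma Amat_mult_eq_0_iff:
  assumes w: "w \<in> carrier_vec (nbr N)"
  shows "Amat N *\<^sub>v w = 0\<^sub>v (nred N + 1) \<longleftrightarrow> A_r N *\<^sub>v w = 0\<^sub>v (nred N)"
proof
  have row: "(A_r N *\<^sub>v w) $ i = (Amat N *\<^sub>v w) $ i" if "i < nred N" for i
    using that w by (simp add: A_r_def Amat_def scalar_prod_def)
  show "A_r N *\<^sub>v w = 0\<^sub>v (nred N)" if "Amat N *\<^sub>v w = 0\<^sub>v (nred N + 1)"
    using row that A_r_carrier[of N] by (intro eq_vecI) auto
  assume r0: "A_r N *\<^sub>v w = 0\<^sub>v (nred N)"
  \<comment> \<open>The columns of the incidence matrix sum to zero, so the slack row is minus the sum of the others.\<close>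
  have "(\<Sum>i\<le>nred N. (Amat N *\<^sub>v w) $ i) = (\<Sum>i\<le>nred N. \<Sum>e<nbr N. Amat N $$ (i, e) * w $ e)"
    using w by (simp add: Amat_def scalar_prod_def lessThan_atLeast0)
  also have "\<dots> = (\<Sum>e<nbr N. (\<Sum>i\<le>nred N. Amat N $$ (i, e)) * w $ e)"
    by (subst sum.swap) (simp add: sum_distrib_right)
  also have "\<dots> = 0"
  proof (intro sum.neutral ballI)
    fix e assume "e \<in> {..<nbr N}"
    then have e: "e < nbr N" by simp
    have "(\<Sum>i\<le>nred N. Amat N $$ (i, e))
        = (\<Sum>i\<le>nred N. (if i = src N e then 1 else 0) - (if i = snk N e then 1 else 0))"
      using e branch_ends(3)[OF e] by (auto simp: Amat_def intro!: sum.cong)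
    also have "\<dots> = 0"
      using branch_ends[OF e] by (simp add: sum_subtractf)
    finally show "(\<Sum>i\<le>nred N. Amat N $$ (i, e)) * w $ e = 0" by simp
  qed
  finally have "(\<Sum>i<nred N. (Amat N *\<^sub>v w) $ i) + (Amat N *\<^sub>v w) $ nred N = 0"
    by (simp add: lessThan_Suc_atMost[symmetric])
  moreover have others: "(Amat N *\<^sub>v w) $ i = 0" if "i < nred N" for i
    using row[OF that] r0 that by simp
  ultimately have "(Amat N *\<^sub>v w) $ i = 0" if "i < nred N + 1" for i
    using that by (cases "i = nred N") auto
  then show "Amat N *\<^sub>v w = 0\<^sub>v (nred N + 1)"
    using Amat_carrier[of N] by (intro eq_vecI) auto
qed

section \<open>From nodal balance to the power flow equations\<close>

text \<open>Row \<open>i\<close> of the balance is the equation at bus \<open>i\<close>. The sign of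
  \<open>A_r\<close> at a sink is absorbed by the oddness of sine, while the unsigned
  \<open>absA_r\<close> fits the evenness of cosine.\<close>

lemma active_power_flow_of_balance:
  assumes \<theta>: "\<theta> \<in> carrier_vec (nred N)"
    and s: "s \<in> carrier_vec (nbr N)" and c: "c \<in> carrier_vec (nbr N)"
    and s_sin: "\<And>e. e < nbr N \<Longrightarrow> s $ e = sin ((transpose_mat (A_r N) *\<^sub>v \<theta>) $ e)"
    and c_cos: "\<And>e. e < nbr N \<Longrightarrow> c $ e = cos ((transpose_mat (A_r N) *\<^sub>v \<theta>) $ e)"
    and balance: "A_r N *\<^sub>v (D_B N *\<^sub>v s) =
      pinj N - G_diag N *\<^sub>v V_r_sq N + absA_r N *\<^sub>v (D_G N *\<^sub>v c)"
  shows "active_power_flow N (\<theta> @\<^sub>v 0\<^sub>v 1)"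
  unfolding active_power_flow_def
proof (intro allI impI)
  let ?w = "\<theta> @\<^sub>v 0\<^sub>v 1" and ?V = "volt N"
  fix i assume i: "i < nred N"
  define S where "S j = Bmat N $$ (i, j) * ?V $ i * ?V $ j * sin (?w $ i - ?w $ j)" for j
  define K where "K j = Gmat N $$ (i, j) * ?V $ i * ?V $ j * cos (?w $ i - ?w $ j)" for j
  have Ds: "D_B N *\<^sub>v s \<in> carrier_vec (nbr N)" and Dc: "D_G N *\<^sub>v c \<in> carrier_vec (nbr N)"
    using D_B_carrier D_G_carrier s c by (blast intro: mult_mat_vec_carrier)+
  have sin_diff_eq: "sin (a - b) = - sin (b - a)" for a b :: real
    by (metis minus_diff_eq sin_minus)
  have cos_diff_eq: "cos (a - b) = cos (b - a)" for a b :: real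
    by (metis minus_diff_eq cos_minus)
  have "(A_r N *\<^sub>v (D_B N *\<^sub>v s)) $ i = (\<Sum>e<nbr N. A_r N $$ (i, e) * (D_B N *\<^sub>v s) $ e)"
    by (rule mult_mat_vec_index_sum[OF A_r_carrier Ds i])
  also have "\<dots> = (\<Sum>e<nbr N. if i = src N e then S (snk N e)
      else if i = snk N e then S (src N e) else 0)"
  proof (intro sum.cong refl)
    fix e assume "e \<in> {..<nbr N}"
    then have e: "e < nbr N" by simp
    have "(D_B N *\<^sub>v s) $ e = ?V $ src N e * ?V $ snk N e * Bmat N $$ (src N e, snk N e) *
        sin (?w $ src N e - ?w $ snk N e)"
      unfolding D_B_def mat_diag_mult_vec_index[OF s e] s_sin[OF e]
        A_r_transpose_mult_index[OF \<theta> e] ..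
    then show "A_r N $$ (i, e) * (D_B N *\<^sub>v s) $ e = (if i = src N e then S (snk N e)
        else if i = snk N e then S (src N e) else 0)"
      using i e branch_ends[OF e] sin_diff_eq[of "?w $ src N e" "?w $ snk N e"]
      by (simp add: A_r_index S_def Bmat_commute[of "src N e" "snk N e"] mult_ac del: index_mult_mat_vec)
  qed
  \<comment> \<open>Buses not adjacent to \<open>i\<close> may be added freely, their susceptance
    being 0.\<close>
  also have "\<dots> = (\<Sum>j\<in>{..nred N} - {i}. S j)"
    unfolding sum_incident_branches using i
    by (intro sum.cong) (auto simp: S_def Bmat_Gmat_nonadjacent)
  finally have lhs: "(A_r N *\<^sub>v (D_B N *\<^sub>v s)) $ i = (\<Sum>j\<in>{..nred N} - {i}. S j)" .
  have "(absA_r N *\<^sub>v (D_G N *\<^sub>v c)) $ i = (\<Sum>e<nbr N. absA_r N $$ (i, e) * (D_G N *\<^sub>v c) $ e)"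
    by (rule mult_mat_vec_index_sum[OF absA_r_carrier Dc i])
  also have "\<dots> = (\<Sum>e<nbr N. if i = src N e then - K (snk N e)
      else if i = snk N e then - K (src N e) else 0)"
  proof (intro sum.cong refl)
    fix e assume "e \<in> {..<nbr N}"
    then have e: "e < nbr N" by simp
    \<comment> \<open>On a branch the conductance is nonpositive, so the absolute value in
      \<open>D_G\<close> is a change of sign. This is why the cosine terms, on the right of the
      balance, end up with the other signs of the power flow equation.\<close>
    have "(D_G N *\<^sub>v c) $ e = ?V $ src N e * ?V $ snk N e * - Gmat N $$ (src N e, snk N e) *
        cos (?w $ src N e - ?w $ snk N e)"
      unfolding D_G_def mat_diag_mult_vec_index[OF c e] c_cos[OF e]
        A_r_transpose_mult_index[OF \<theta> e]
      using Gmat_nonpos[OF adjacent_branch[OF e]] by simp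
    moreover have "absA_r N $$ (i, e) = (if i = src N e \<or> i = snk N e then 1 else 0)"
      using i e A_r_index[OF i e] A_r_carrier[of N] by (simp add: absA_r_def)
    ultimately show "absA_r N $$ (i, e) * (D_G N *\<^sub>v c) $ e = (if i = src N e then - K (snk N e)
        else if i = snk N e then - K (src N e) else 0)"
      using branch_ends[OF e] cos_diff_eq[of "?w $ src N e" "?w $ snk N e"]
      by (simp add: K_def Gmat_commute[of "src N e" "snk N e"] mult_ac del: index_mult_mat_vec)
  qed
  also have "\<dots> = (\<Sum>j\<in>{..nred N} - {i}. - K j)"
    unfolding sum_incident_branches[of i "\<lambda>j. - K j"] using i
    by (intro sum.cong) (auto simp: K_def Bmat_Gmat_nonadjacent)
  finally have rhs: "(absA_r N *\<^sub>v (D_G N *\<^sub>v c)) $ i = - (\<Sum>j\<in>{..nred N} - {i}. K j)"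
    by (simp add: sum_negf)
  have Vr: "V_r_sq N \<in> carrier_vec (nred N)" "V_r_sq N $ i = (?V $ i)\<^sup>2"
    using i by (simp_all add: V_r_sq_def vec_first_def)
  have "(G_diag N *\<^sub>v V_r_sq N) $ i = Gmat N $$ (i, i) * (?V $ i)\<^sup>2"
    unfolding G_diag_def mat_diag_mult_vec_index[OF Vr(1) i] Vr(2) ..
  moreover have "(A_r N *\<^sub>v (D_B N *\<^sub>v s)) $ i = pinj N $ i - (G_diag N *\<^sub>v V_r_sq N) $ i
      + (absA_r N *\<^sub>v (D_G N *\<^sub>v c)) $ i"
    unfolding balance using i G_diag_carrier[of N] absA_r_carrier[of N] net
    by (simp add: power_network_def del: index_mult_mat_vec)
  ultimately show "pinj N $ i = (\<Sum>j\<in>{..nred N} - {i}. Bmat N $$ (i, j) * ?V $ i * ?V $ j *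
        sin (?w $ i - ?w $ j)) + Gmat N $$ (i, i) * (?V $ i)\<^sup>2 +
      (\<Sum>j\<in>{..nred N} - {i}. Gmat N $$ (i, j) * ?V $ i * ?V $ j * cos (?w $ i - ?w $ j))"
    using lhs rhs by (simp add: S_def K_def)
qed

section \<open>Inverses appearing in the iteration\<close>

lemma inv_mat_A_r_gram:
  shows "A_r N * transpose_mat (A_r N) * inv_mat (A_r N * transpose_mat (A_r N)) = 1\<^sub>m (nred N)"
    and "inv_mat (A_r N * transpose_mat (A_r N)) \<in> carrier_mat (nred N) (nred N)"
proof -
  have tA: "transpose_mat (A_r N) \<in> carrier_mat (nbr N) (nred N)"
    using A_r_carrier[of N] by simp
  have AA: "A_r N * transpose_mat (A_r N) \<in> carrier_mat (nred N) (nred N)"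
    by (rule mult_carrier_mat[OF A_r_carrier tA])
  \<comment> \<open>Unit weights are inserted to match the form of
    \<open>weighted_gram_injective\<close>.\<close>
  have "A_r N * mat_diag (nbr N) (\<lambda>_. 1) * transpose_mat (A_r N) = A_r N * transpose_mat (A_r N)"
    using A_r_carrier[of N] by simp
  then have "v = 0\<^sub>v (nred N)" if "v \<in> carrier_vec (nred N)"
      "A_r N * transpose_mat (A_r N) *\<^sub>v v = 0\<^sub>v (nred N)" for v
    using weighted_gram_injective[OF tA, of "\<lambda>_. 1" v] A_r_transpose_injective that by simp
  from inv_mat_of_injective[OF AA this]
  show "A_r N * transpose_mat (A_r N) * inv_mat (A_r N * transpose_mat (A_r N)) = 1\<^sub>m (nred N)"
    "inv_mat (A_r N * transpose_mat (A_r N)) \<in> carrier_mat (nred N) (nred N)"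
    by blast+
qed

lemma inv_mat_L_B:
  shows "L_B N * inv_mat (L_B N) = 1\<^sub>m (nred N)"
    and "inv_mat (L_B N) \<in> carrier_mat (nred N) (nred N)"
proof -
  have tA: "transpose_mat (A_r N) \<in> carrier_mat (nbr N) (nred N)"
    using A_r_carrier[of N] by simp
  have L: "L_B N \<in> carrier_mat (nred N) (nred N)"
    unfolding L_B_def by (rule mult_carrier_mat[OF mult_carrier_mat[OF A_r_carrier D_B_carrier] tA])
  have "v = 0\<^sub>v (nred N)" if "v \<in> carrier_vec (nred N)" "L_B N *\<^sub>v v = 0\<^sub>v (nred N)" for v
    by (rule weighted_gram_injective[OF tA D_B_entry_pos A_r_transpose_injective])
      (use that in \<open>auto simp: L_B_def D_B_def\<close>)
  from inv_mat_of_injective[OF L this]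
  show "L_B N * inv_mat (L_B N) = 1\<^sub>m (nred N)"
    "inv_mat (L_B N) \<in> carrier_mat (nred N) (nred N)"
    by blast+
qed

lemma D_B_mult_inv_mat: "D_B N * inv_mat (D_B N) = 1\<^sub>m (nbr N)"
  and inv_mat_D_B_carrier: "inv_mat (D_B N) \<in> carrier_mat (nbr N) (nbr N)"
proof -
  have inv: "inv_mat (D_B N) = mat_diag (nbr N)
      (\<lambda>e. inverse (volt N $ src N e * volt N $ snk N e * Bmat N $$ (src N e, snk N e)))"
    unfolding D_B_def by (rule inv_mat_diag) (use D_B_entry_pos in force)
  then show "inv_mat (D_B N) \<in> carrier_mat (nbr N) (nbr N)" by simp
  show "D_B N * inv_mat (D_B N) = 1\<^sub>m (nbr N)"
    unfolding D_B_def by (rule inv_mat_diag) (use D_B_entry_pos in force)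
qed

section \<open>The cycle space and its orthogonal complement\<close>

context
  fixes C :: "real mat"
  assumes C: "C \<in> carrier_mat (nbr N) (kernel_dim (Amat N))"
    and basis: "kernel.basis (nbr N) (Amat N) (set (cols C))"
begin

lemma inv_mat_cycle_gram:
  defines "R \<equiv> transpose_mat C * inv_mat (D_B N) * C"
  shows "R * inv_mat R = 1\<^sub>m (dim_col C)"
    and "inv_mat R \<in> carrier_mat (dim_col C) (dim_col C)"
proof -
  let ?d = "\<lambda>e. inverse (volt N $ src N e * volt N $ snk N e * Bmat N $$ (src N e, snk N e))"
  have C': "C \<in> carrier_mat (nbr N) (dim_col C)" and dim: "dim_col C = kernel_dim (Amat N)"
    using C by auto
  have R: "R \<in> carrier_mat (dim_col C) (dim_col C)"
    unfolding R_def
    by (rule mult_carrier_mat[OF mult_carrier_mat[OF transpose_carrier_mat[THEN iffD2, OF C'] inv_mat_D_B_carrier] C'])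
  have inv: "inv_mat (D_B N) = mat_diag (nbr N) ?d"
    unfolding D_B_def by (rule inv_mat_diag) (use D_B_entry_pos in force)
  have d: "?d e > 0" if "e < nbr N" for e
    using D_B_entry_pos[OF that] by (rule positive_imp_inverse_positive)
  have "v = 0\<^sub>v (dim_col C)" if v: "v \<in> carrier_vec (dim_col C)" "R *\<^sub>v v = 0\<^sub>v (dim_col C)" for v
  proof (rule weighted_gram_injective[OF C' d])
    show "u = 0\<^sub>v (dim_col C)" if "u \<in> carrier_vec (dim_col C)" "C *\<^sub>v u = 0\<^sub>v (nbr N)" for u
      using kernel_basis_matrix_injective[OF Amat_carrier C basis] that dim by simp
  qed (use v in \<open>simp_all add: R_def inv\<close>)
  from inv_mat_of_injective[OF R this]
  show "R * inv_mat R = 1\<^sub>m (dim_col C)" "inv_mat R \<in> carrier_mat (dim_col C) (dim_col C)"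
    by blast+
qed

text \<open>A combination of cycles is a circulation, with no net flow at any bus.\<close>

lemma A_r_mult_cycle_matrix:
  assumes "z \<in> carrier_vec (dim_col C)"
  shows "A_r N *\<^sub>v (C *\<^sub>v z) = 0\<^sub>v (nred N)"
proof -
  have "C *\<^sub>v z \<in> carrier_vec (nbr N)"
    using C assms by auto
  moreover have "C *\<^sub>v z \<in> mat_kernel (Amat N)"
    unfolding kernel_basis_matrix_image[OF Amat_carrier C basis] using assms C by auto
  ultimately show ?thesis
    using mat_kernelD(2)[OF Amat_carrier] Amat_mult_eq_0_iff by blast
qed

text \<open>The residual \<open>r\<close> of the least-squares fit is shown to be orthogonal to
  itself, which avoids any dimension count. The normal equations put \<open>r\<close> into the
  kernel, hence into the range of \<open>C\<close>, where \<open>a\<close> is orthogonal to it; the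
  fitted part is orthogonal to it since \<open>A_r\<close> annihilates \<open>r\<close>.\<close>

lemma A_r_transpose_projection:
  assumes a: "a \<in> carrier_vec (nbr N)" and orth: "transpose_mat C *\<^sub>v a = 0\<^sub>v (dim_col C)"
  shows "transpose_mat (A_r N) *\<^sub>v
    (inv_mat (A_r N * transpose_mat (A_r N)) *\<^sub>v (A_r N *\<^sub>v a)) = a"
proof -
  let ?T = "transpose_mat (A_r N)"
  define y where "y = inv_mat (A_r N * ?T) *\<^sub>v (A_r N *\<^sub>v a)"
  define r where "r = a - ?T *\<^sub>v y"
  have T: "?T \<in> carrier_mat (nbr N) (nred N)"
    using A_r_carrier[of N] by simp
  have Aa: "A_r N *\<^sub>v a \<in> carrier_vec (nred N)"
    by (rule mult_mat_vec_carrier[OF A_r_carrier a])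
  have y: "y \<in> carrier_vec (nred N)"
    unfolding y_def by (rule mult_mat_vec_carrier[OF inv_mat_A_r_gram(2) Aa])
  have Ty: "?T *\<^sub>v y \<in> carrier_vec (nbr N)"
    by (rule mult_mat_vec_carrier[OF T y])
  have r: "r \<in> carrier_vec (nbr N)"
    unfolding r_def using a Ty by simp
  have "A_r N *\<^sub>v (?T *\<^sub>v y) = (A_r N * ?T) *\<^sub>v y"
    by (rule assoc_mult_mat_vec[OF A_r_carrier T y, symmetric])
  also have "\<dots> = (A_r N * ?T * inv_mat (A_r N * ?T)) *\<^sub>v (A_r N *\<^sub>v a)"
    unfolding y_def
    by (rule assoc_mult_mat_vec[OF mult_carrier_mat[OF A_r_carrier T] inv_mat_A_r_gram(2) Aa, symmetric])
  also have "\<dots> = A_r N *\<^sub>v a"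
    unfolding inv_mat_A_r_gram(1) using Aa by simp
  finally have Ar: "A_r N *\<^sub>v r = 0\<^sub>v (nred N)"
    unfolding r_def mult_minus_distrib_mat_vec[OF A_r_carrier a Ty] using Aa by simp
  then have "r \<in> mat_kernel (Amat N)"
    using Amat_mult_eq_0_iff[OF r] by (intro mat_kernelI[OF Amat_carrier r]) simp
  then obtain z where z: "z \<in> carrier_vec (dim_col C)" "r = C *\<^sub>v z"
    unfolding kernel_basis_matrix_image[OF Amat_carrier C basis] using C by auto
  have C': "C \<in> carrier_mat (nbr N) (dim_col C)" using C by auto
  have "a \<bullet> r = (transpose_mat C *\<^sub>v a) \<bullet> z"
    unfolding z(2) by (rule transpose_vec_mult_scalar[OF C' z(1) a, symmetric])
  also have "\<dots> = 0"
    unfolding orth using z(1) by simp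
  finally have ar: "a \<bullet> r = 0" .
  have "(?T *\<^sub>v y) \<bullet> r = y \<bullet> (A_r N *\<^sub>v r)"
    by (rule transpose_vec_mult_scalar[OF A_r_carrier r y])
  then have "(?T *\<^sub>v y) \<bullet> r = 0"
    unfolding Ar using y by simp
  then have "r \<bullet> r = 0"
    using ar minus_scalar_prod_distrib[OF a Ty r] by (simp add: r_def[symmetric])
  then have "r = 0\<^sub>v (nbr N)"
    using conjugate_square_eq_0_vec[OF r] by simp
  then have "a $ e = (?T *\<^sub>v y) $ e" if "e < nbr N" for e
    using that a Ty by (metis (no_types, lifting) carrier_vecD eq_iff_diff_eq_0 index_minus_vec(1) index_zero_vec(1) r_def)
  then show ?thesis
    unfolding y_def[symmetric] using a Ty by (intro eq_vecI) (simp_all del: index_mult_mat_vec dim_mult_mat_vec)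
qed

text \<open>As \<open>b\<close> and \<open>z\<close> are arbitrary, this concerns any vector of the
  form produced by the update, not only the limit. The first term reproduces \<open>L_B\<close> in
  front of its inverse; in the second \<open>D_B\<close> cancels and a circulation is left.\<close>

lemma A_r_D_B_mult_step:
  assumes b: "b \<in> carrier_vec (nred N)" and z: "z \<in> carrier_vec (dim_col C)"
  shows "A_r N *\<^sub>v (D_B N *\<^sub>v (transpose_mat (A_r N) *\<^sub>v (inv_mat (L_B N) *\<^sub>v b)
    + inv_mat (D_B N) *\<^sub>v (C *\<^sub>v z))) = b"
proof -
  let ?T = "transpose_mat (A_r N)"
  have T: "?T \<in> carrier_mat (nbr N) (nred N)"
    using A_r_carrier[of N] by simp
  have y: "inv_mat (L_B N) *\<^sub>v b \<in> carrier_vec (nred N)" (is "?y \<in> _")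
    by (rule mult_mat_vec_carrier[OF inv_mat_L_B(2) b])
  have Ty: "?T *\<^sub>v ?y \<in> carrier_vec (nbr N)"
    by (rule mult_mat_vec_carrier[OF T y])
  have Cz: "C *\<^sub>v z \<in> carrier_vec (nbr N)"
    using C z by auto
  have DCz: "inv_mat (D_B N) *\<^sub>v (C *\<^sub>v z) \<in> carrier_vec (nbr N)"
    by (rule mult_mat_vec_carrier[OF inv_mat_D_B_carrier Cz])
  have L: "L_B N \<in> carrier_mat (nred N) (nred N)"
    unfolding L_B_def by (rule mult_carrier_mat[OF mult_carrier_mat[OF A_r_carrier D_B_carrier] T])
  have "L_B N *\<^sub>v ?y = (A_r N * D_B N) *\<^sub>v (?T *\<^sub>v ?y)"
    by (subst L_B_def) (rule assoc_mult_mat_vec[OF mult_carrier_mat[OF A_r_carrier D_B_carrier] T y])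
  also have "\<dots> = A_r N *\<^sub>v (D_B N *\<^sub>v (?T *\<^sub>v ?y))"
    by (rule assoc_mult_mat_vec[OF A_r_carrier D_B_carrier Ty])
  finally have "A_r N *\<^sub>v (D_B N *\<^sub>v (?T *\<^sub>v ?y)) = L_B N *\<^sub>v ?y" ..
  also have "\<dots> = (L_B N * inv_mat (L_B N)) *\<^sub>v b"
    by (rule assoc_mult_mat_vec[OF L inv_mat_L_B(2) b, symmetric])
  also have "\<dots> = b"
    unfolding inv_mat_L_B(1) using b by simp
  finally have 1: "A_r N *\<^sub>v (D_B N *\<^sub>v (?T *\<^sub>v ?y)) = b" .
  have "D_B N *\<^sub>v (inv_mat (D_B N) *\<^sub>v (C *\<^sub>v z)) = (D_B N * inv_mat (D_B N)) *\<^sub>v (C *\<^sub>v z)"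
    by (rule assoc_mult_mat_vec[OF D_B_carrier inv_mat_D_B_carrier Cz, symmetric])
  also have "\<dots> = C *\<^sub>v z"
    unfolding D_B_mult_inv_mat using Cz by simp
  finally have 2: "A_r N *\<^sub>v (D_B N *\<^sub>v (inv_mat (D_B N) *\<^sub>v (C *\<^sub>v z))) = 0\<^sub>v (nred N)"
    using A_r_mult_cycle_matrix[OF z] by simp
  show ?thesis
    unfolding mult_add_distrib_mat_vec[OF D_B_carrier Ty DCz]
      mult_add_distrib_mat_vec[OF A_r_carrier
        mult_mat_vec_carrier[OF D_B_carrier Ty] mult_mat_vec_carrier[OF D_B_carrier DCz]] 1 2
    using b by simp
qed

end

end

section \<open>Passage to the limit in the iteration\<close>

theorem mainTheorem1:
  fixes N :: network and C :: "real mat"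
    and x \<psi> \<theta> :: "nat \<Rightarrow> real vec" and xstar \<psi>star :: "real vec"
  assumes "power_network N"
    and "cycle_matrix N C"
    and "x 0 \<in> carrier_vec (dim_col C)"
    and "\<psi> 0 \<in> carrier_vec (nbr N)"
    and "\<theta> 0 \<in> carrier_vec (nred N)"
    and "\<forall>k. \<forall>e<nbr N. \<bar>\<psi> k $ e\<bar> \<le> 1"
    and "\<forall>k. x (Suc k) =
           x k - inv_mat (transpose_mat C * inv_mat (D_B N) * C) *\<^sub>v
                   (transpose_mat C *\<^sub>v map_vec arcsin (\<psi> k))"
    and "\<forall>k. \<psi> (Suc k) =
           transpose_mat (A_r N) *\<^sub>v (inv_mat (L_B N) *\<^sub>v
             (pinj N - G_diag N *\<^sub>v V_r_sq N +
              absA_r N *\<^sub>v (D_G N *\<^sub>v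
                map_vec sqrt (vec (nbr N) (\<lambda>_. 1) - map_vec (\<lambda>s. s\<^sup>2) (\<psi> k)))))
           + inv_mat (D_B N) *\<^sub>v (C *\<^sub>v x (Suc k))"
    and "\<forall>k. \<theta> (Suc k) =
           inv_mat (A_r N * transpose_mat (A_r N)) *\<^sub>v
             (A_r N *\<^sub>v map_vec arcsin (\<psi> (Suc k)))"
    and "xstar \<in> carrier_vec (dim_col C)"
    and "\<psi>star \<in> carrier_vec (nbr N)"
    and "vec_tendsto x xstar"
    and "vec_tendsto \<psi> \<psi>star"
  shows "\<exists>\<theta>star \<in> carrier_vec (nred N).
           vec_tendsto (\<lambda>k. transpose_mat (A_r N) *\<^sub>v \<theta> k) (transpose_mat (A_r N) *\<^sub>v \<theta>star) \<and>
           (\<forall>e<nbr N. [(transpose_mat (A_r N) *\<^sub>v \<theta>star) $ e = arcsin (\<psi>star $ e)] (rmod 2 * pi)) \<and>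
           active_power_flow N (\<theta>star @\<^sub>v 0\<^sub>v 1)"
proof -
  note net = assms(1) and x_step = assms(7)[rule_format] and \<psi>_step = assms(8)[rule_format]
    and \<theta>_step = assms(9)[rule_format] and xs = assms(10) and \<psi>s = assms(11)
    and x_lim = assms(12) and \<psi>_lim = assms(13)
  have C: "C \<in> carrier_mat (nbr N) (kernel_dim (Amat N))"
    and basis: "kernel.basis (nbr N) (Amat N) (set (cols C))"
    using assms(2) by (auto simp: cycle_matrix_def)
  have C': "C \<in> carrier_mat (nbr N) (dim_col C)" and tC: "transpose_mat C \<in> carrier_mat (dim_col C) (nbr N)"
    using C by auto
  let ?T = "transpose_mat (A_r N)"
  have T: "?T \<in> carrier_mat (nbr N) (nred N)"
    using A_r_carrier[of N] by simp
  have dim\<psi>: "dim_vec \<psi>star = nbr N" using \<psi>s by simp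
  have \<psi>_range: "\<psi> k $ e \<in> {-1..1}" if "e < dim_vec \<psi>star" for k e
    using assms(6)[rule_format, of e k] that dim\<psi> by auto
  define a where "a = map_vec arcsin \<psi>star"
  have a: "a \<in> carrier_vec (nbr N)" using \<psi>s by (simp add: a_def)
  have a_lim: "vec_tendsto (\<lambda>k. map_vec arcsin (\<psi> k)) a"
    unfolding a_def
    by (rule vec_tendsto_map[OF \<psi>_lim continuous_on_arcsin' closed_atLeastAtMost \<psi>_range])

  define R where "R = transpose_mat C * inv_mat (D_B N) * C"
  have Rinv: "R * inv_mat R = 1\<^sub>m (dim_col C)" "inv_mat R \<in> carrier_mat (dim_col C) (dim_col C)"
    using inv_mat_cycle_gram[OF net C basis] by (simp_all add: R_def)
  have R: "R \<in> carrier_mat (dim_col C) (dim_col C)"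
    unfolding R_def
    by (rule mult_carrier_mat[OF mult_carrier_mat[OF tC inv_mat_D_B_carrier[OF net]] C'])
  have Ca: "transpose_mat C *\<^sub>v a \<in> carrier_vec (dim_col C)"
    by (rule mult_mat_vec_carrier[OF tC a])
  \<comment> \<open>The limit of the corrections subtracted from \<open>x\<close>. Since
    \<open>x\<close> and its shift have the same limit, \<open>u\<close> must vanish.\<close>
  define u where "u = inv_mat R *\<^sub>v (transpose_mat C *\<^sub>v a)"
  have u: "u \<in> carrier_vec (dim_col C)"
    unfolding u_def by (rule mult_mat_vec_carrier[OF Rinv(2) Ca])
  have u_lim: "vec_tendsto (\<lambda>k. inv_mat R *\<^sub>v (transpose_mat C *\<^sub>v map_vec arcsin (\<psi> k))) u"
    unfolding u_def by (rule vec_tendsto_mult_mat[OF Rinv(2) Ca vec_tendsto_mult_mat[OF tC a a_lim]])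
  have "vec_tendsto (\<lambda>k. x (Suc k)) (xstar - u)"
    unfolding x_step R_def[symmetric]
    by (rule vec_tendsto_diff[OF x_lim u_lim]) (use xs u in simp)
  then have fix_x: "xstar = xstar - u"
    by (rule vec_tendsto_unique[OF vec_tendsto_Suc[OF x_lim]])
  have "u $ i = 0" if i: "i < dim_col C" for i
  proof -
    have "xstar $ i = (xstar - u) $ i"
      by (rule arg_cong[OF fix_x, of "\<lambda>v. v $ i"])
    also have "\<dots> = xstar $ i - u $ i"
      using i u by simp
    finally show ?thesis by linarith
  qed
  then have "u = 0\<^sub>v (dim_col C)"
    using u by (intro eq_vecI) auto
  \<comment> \<open>Multiplication by \<open>R\<close> removes its inverse from \<open>u\<close>,
    leaving the bare orthogonality condition.\<close>
  then have "R *\<^sub>v u = 0\<^sub>v (dim_col C)"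
    using R by (auto simp: scalar_prod_def)
  then have orth: "transpose_mat C *\<^sub>v a = 0\<^sub>v (dim_col C)"
    using assoc_mult_mat_vec[OF R Rinv(2) Ca] Rinv(1) Ca by (simp add: u_def)

  define \<theta>s where "\<theta>s = inv_mat (A_r N * ?T) *\<^sub>v (A_r N *\<^sub>v a)"
  have Aa: "A_r N *\<^sub>v a \<in> carrier_vec (nred N)"
    by (rule mult_mat_vec_carrier[OF A_r_carrier a])
  have \<theta>s: "\<theta>s \<in> carrier_vec (nred N)"
    unfolding \<theta>s_def by (rule mult_mat_vec_carrier[OF inv_mat_A_r_gram(2)[OF net] Aa])
  have T\<theta>: "?T *\<^sub>v \<theta>s = a"
    unfolding \<theta>s_def by (rule A_r_transpose_projection[OF net C basis a orth])
  have "vec_tendsto (\<lambda>k. \<theta> (Suc k)) \<theta>s"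
    unfolding \<theta>_step \<theta>s_def
    by (rule vec_tendsto_mult_mat[OF inv_mat_A_r_gram(2)[OF net] Aa
          vec_tendsto_mult_mat[OF A_r_carrier a vec_tendsto_Suc[OF a_lim]]])
  then have "vec_tendsto \<theta> \<theta>s"
    by (rule vec_tendsto_if_Suc) (use assms(5) \<theta>s in simp)
  then have \<theta>_lim: "vec_tendsto (\<lambda>k. ?T *\<^sub>v \<theta> k) (?T *\<^sub>v \<theta>s)"
    by (rule vec_tendsto_mult_mat[OF T \<theta>s])

  define cs where "cs = map_vec sqrt (vec (nbr N) (\<lambda>_. 1) - map_vec (\<lambda>s. s\<^sup>2) \<psi>star)"
  have cs: "cs \<in> carrier_vec (nbr N)" using \<psi>s by (simp add: cs_def)
  \<comment> \<open>Unlike \<open>arcsin\<close>, the total function \<open>sqrt\<close> is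
    continuous on all reals, so no range condition enters here.\<close>
  have cs_lim: "vec_tendsto (\<lambda>k. map_vec sqrt (vec (nbr N) (\<lambda>_. 1) - map_vec (\<lambda>s. s\<^sup>2) (\<psi> k))) cs"
    unfolding cs_def
  proof (rule vec_tendsto_map[where S = UNIV])
    show "vec_tendsto (\<lambda>k. vec (nbr N) (\<lambda>_. 1) - map_vec (\<lambda>s. s\<^sup>2) (\<psi> k))
        (vec (nbr N) (\<lambda>_. 1) - map_vec (\<lambda>s. s\<^sup>2) \<psi>star)"
    proof (rule vec_tendsto_diff[OF vec_tendsto_const])
      show "vec_tendsto (\<lambda>k. map_vec (\<lambda>s. s\<^sup>2) (\<psi> k)) (map_vec (\<lambda>s. s\<^sup>2) \<psi>star)"
        by (rule vec_tendsto_map[where S = UNIV, OF \<psi>_lim])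
          (rule continuous_on_power[OF continuous_on_id] closed_UNIV UNIV_I)+
    qed (simp add: dim\<psi>)
  qed (rule continuous_on_real_sqrt[OF continuous_on_id] closed_UNIV UNIV_I)+
  define b where "b = pinj N - G_diag N *\<^sub>v V_r_sq N + absA_r N *\<^sub>v (D_G N *\<^sub>v cs)"
  have Dcs: "D_G N *\<^sub>v cs \<in> carrier_vec (nbr N)"
    by (rule mult_mat_vec_carrier[OF D_G_carrier cs])
  have b: "b \<in> carrier_vec (nred N)"
    unfolding b_def using absA_r_carrier[of N] by (intro carrier_vecI) simp
  have Lb: "inv_mat (L_B N) *\<^sub>v b \<in> carrier_vec (nred N)"
    by (rule mult_mat_vec_carrier[OF inv_mat_L_B(2)[OF net] b])
  have Cx: "C *\<^sub>v xstar \<in> carrier_vec (nbr N)"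
    by (rule mult_mat_vec_carrier[OF C' xs])
  have dimL: "dim_vec (pinj N - G_diag N *\<^sub>v V_r_sq N) = nred N"
    using G_diag_carrier[of N] by simp
  have b_lim: "vec_tendsto (\<lambda>k. pinj N - G_diag N *\<^sub>v V_r_sq N + absA_r N *\<^sub>v (D_G N *\<^sub>v
      map_vec sqrt (vec (nbr N) (\<lambda>_. 1) - map_vec (\<lambda>s. s\<^sup>2) (\<psi> k)))) b"
    unfolding b_def
    by (rule vec_tendsto_add[OF vec_tendsto_const
          vec_tendsto_mult_mat[OF absA_r_carrier Dcs vec_tendsto_mult_mat[OF D_G_carrier cs cs_lim]]])
      (use dimL absA_r_carrier[of N] in simp)
  have 1: "vec_tendsto (\<lambda>k. ?T *\<^sub>v (inv_mat (L_B N) *\<^sub>v (pinj N - G_diag N *\<^sub>v V_r_sq N +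
      absA_r N *\<^sub>v (D_G N *\<^sub>v map_vec sqrt (vec (nbr N) (\<lambda>_. 1) - map_vec (\<lambda>s. s\<^sup>2) (\<psi> k))))))
      (?T *\<^sub>v (inv_mat (L_B N) *\<^sub>v b))"
    by (rule vec_tendsto_mult_mat[OF T Lb
          vec_tendsto_mult_mat[OF inv_mat_L_B(2)[OF net] b b_lim]])
  have 2: "vec_tendsto (\<lambda>k. inv_mat (D_B N) *\<^sub>v (C *\<^sub>v x (Suc k)))
      (inv_mat (D_B N) *\<^sub>v (C *\<^sub>v xstar))"
    by (rule vec_tendsto_mult_mat[OF inv_mat_D_B_carrier[OF net] Cx
          vec_tendsto_mult_mat[OF C' xs vec_tendsto_Suc[OF x_lim]]])
  have "vec_tendsto (\<lambda>k. \<psi> (Suc k))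
      (?T *\<^sub>v (inv_mat (L_B N) *\<^sub>v b) + inv_mat (D_B N) *\<^sub>v (C *\<^sub>v xstar))"
    unfolding \<psi>_step by (rule vec_tendsto_add[OF 1 2]) (use T inv_mat_D_B_carrier[OF net] in simp)
  then have fix_\<psi>: "\<psi>star = ?T *\<^sub>v (inv_mat (L_B N) *\<^sub>v b) + inv_mat (D_B N) *\<^sub>v (C *\<^sub>v xstar)"
    by (rule vec_tendsto_unique[OF vec_tendsto_Suc[OF \<psi>_lim]])
  have balance: "A_r N *\<^sub>v (D_B N *\<^sub>v \<psi>star) = b"
    by (subst fix_\<psi>) (rule A_r_D_B_mult_step[OF net C basis b xs])

  \<comment> \<open>Outside this interval \<open>arcsin\<close> has no specified value, so the bound
    must survive the limit before sine and cosine of \<open>arcsin\<close> can be evaluated.\<close>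
  have \<psi>s_range: "-1 \<le> \<psi>star $ e \<and> \<psi>star $ e \<le> 1" if "e < nbr N" for e
  proof -
    have "(\<lambda>k. \<psi> k $ e) \<longlonglongrightarrow> \<psi>star $ e"
      using \<psi>_lim that dim\<psi> by (simp add: vec_tendsto_def)
    from Lim_in_closed_set[OF closed_atLeastAtMost _ _ this, of "-1" 1]
    show ?thesis using \<psi>_range that dim\<psi> by simp
  qed
  have "active_power_flow N (\<theta>s @\<^sub>v 0\<^sub>v 1)"
  proof (rule active_power_flow_of_balance[OF net \<theta>s \<psi>s cs])
    show "\<psi>star $ e = sin ((?T *\<^sub>v \<theta>s) $ e)" if "e < nbr N" for e
      unfolding T\<theta> a_def using that dim\<psi> \<psi>s_range[OF that] by simp
    show "cs $ e = cos ((?T *\<^sub>v \<theta>s) $ e)" if "e < nbr N" for e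
      unfolding T\<theta> a_def cs_def using that dim\<psi> \<psi>s_range[OF that] by (simp add: cos_arcsin)
    show "A_r N *\<^sub>v (D_B N *\<^sub>v \<psi>star) =
        pinj N - G_diag N *\<^sub>v V_r_sq N + absA_r N *\<^sub>v (D_G N *\<^sub>v cs)"
      using balance by (simp add: b_def)
  qed
  moreover have "[(?T *\<^sub>v \<theta>s) $ e = arcsin (\<psi>star $ e)] (rmod 2 * pi)" if "e < nbr N" for e
    unfolding T\<theta> a_def using that dim\<psi> by simp
  ultimately show ?thesis
    by (intro bexI[OF _ \<theta>s] conjI \<theta>_lim) simp_all
qed

end
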